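(* Let $s:\mathbb{R}\to\mathbb{C}$ be a smooth regular parametrized curve. Then $s$ is Möbius equivalent to an arc length parametrized curve (i.e. there is a Möbius transformation $M$ of $\mathbb{C}\cup\{\infty\}$ such that $M\circ s$ is a curve in $\mathbb{C}$ parametrized by arc length) if and only if the circles $C(u)$, $u\in\mathbb{R}$, all pass through one common point of $\mathbb{C}\cup\{\infty\}$, where $C(u)$ denotes the circle orthogonal to the curvature circle of $s$ at $s(u)$ and passing through $s(u)$ and $\tilde s(u)$.
   Context: Regular means $s'\neq0$ everywhere. For each $u$, $$\tilde s(u):=s(u)-\frac{2\,s'(u)^2}{s''(u)}\in\mathbb{C}\cup\{\infty\}$$ (complex multiplication and division; $\tilde s(u)=\infty$ if $s''(u)=0$); this is a point of the curvature circle of $s$ at $s(u)$ different from $s(u)$. The curvature circle is the osculating circle, with center $s+\frac1\kappa N$ and radius $1/|\kappa|$, where $\kappa=\det(s',s'')/\|s'\|^3$ and $N=is'/|s'|$; if $\kappa(u)=0$ it is the tangent line. Straight lines together with $\infty$ count as circles. A Möbius transformation of $\mathbb{C}\cup\{\infty\}$ is a composition of finitely many inversions in circles (so similarities are Möbius transformations). *)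

theory Defs
  imports "HOL-Analysis.Analysis"
begin

section \<open>Smooth curves in the complex plane\<close>

definition curve_deriv :: "(real \<Rightarrow> complex) \<Rightarrow> real \<Rightarrow> complex" where
  "curve_deriv f u = vector_derivative f (at u)"

definition smooth_curve :: "(real \<Rightarrow> complex) \<Rightarrow> bool" where
  "smooth_curve f \<longleftrightarrow> (\<forall>n u. (curve_deriv ^^ n) f differentiable (at u))"

definition regular_curve :: "(real \<Rightarrow> complex) \<Rightarrow> bool" where
  "regular_curve f \<longleftrightarrow> (\<forall>u. curve_deriv f u \<noteq> 0)"

definition arc_length_parametrized :: "(real \<Rightarrow> complex) \<Rightarrow> bool" where
  "arc_length_parametrized f \<longleftrightarrow> smooth_curve f \<and> (\<forall>u. norm (curve_deriv f u) = 1)"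

definition normal_vec :: "(real \<Rightarrow> complex) \<Rightarrow> real \<Rightarrow> complex" where
  "normal_vec s u = \<i> * curve_deriv s u / of_real (norm (curve_deriv s u))"

definition det2 :: "complex \<Rightarrow> complex \<Rightarrow> real" where
  "det2 v w = Re v * Im w - Im v * Re w"

definition curvature :: "(real \<Rightarrow> complex) \<Rightarrow> real \<Rightarrow> real" where
  "curvature s u =
     det2 (curve_deriv s u) (curve_deriv (curve_deriv s) u) / norm (curve_deriv s u) ^ 3"

section \<open>The extended plane, its circles, and Moebius transformations\<close>

text \<open>As for the one-point compactification in the library, \<^const>\<open>None\<close> is the point at infinity.\<close>

type_synonym ext_complex = "complex option"

definition euclidean_circle :: "complex \<Rightarrow> real \<Rightarrow> ext_complex set" where
  "euclidean_circle c r = Some ` sphere c r"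

definition ext_line :: "complex \<Rightarrow> complex \<Rightarrow> ext_complex set" where
  "ext_line p d = insert None (Some ` range (\<lambda>t::real. p + t *\<^sub>R d))"

definition is_circle :: "ext_complex set \<Rightarrow> bool" where
  "is_circle C \<longleftrightarrow>
     (\<exists>c r. r > 0 \<and> C = euclidean_circle c r) \<or> (\<exists>p d. d \<noteq> 0 \<and> C = ext_line p d)"

text \<open>The finite point \<open>z\<close> lies on the circle \<open>C\<close>, and \<open>v\<close> is a (possibly zero) vector tangent
  to \<open>C\<close> at \<open>z\<close>.\<close>

definition tangent_at :: "ext_complex set \<Rightarrow> complex \<Rightarrow> complex \<Rightarrow> bool" where
  "tangent_at C z v \<longleftrightarrow> Some z \<in> C \<and>
     ((\<exists>c r. r > 0 \<and> C = euclidean_circle c r \<and> orthogonal v (z - c)) \<or>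
      (\<exists>p d. d \<noteq> 0 \<and> C = ext_line p d \<and> (\<exists>t::real. v = t *\<^sub>R d)))"

text \<open>Orthogonal circles always have a finite common point, even if both are lines, so angles
  need not be measured at infinity.\<close>

definition circles_orthogonal :: "ext_complex set \<Rightarrow> ext_complex set \<Rightarrow> bool" where
  "circles_orthogonal C D \<longleftrightarrow> (\<exists>z. Some z \<in> C \<inter> D) \<and>
     (\<forall>z v w. Some z \<in> C \<inter> D \<longrightarrow> tangent_at C z v \<longrightarrow> tangent_at D z w \<longrightarrow> orthogonal v w)"

fun circle_inversion :: "complex \<Rightarrow> real \<Rightarrow> ext_complex \<Rightarrow> ext_complex" where
  "circle_inversion c r None = Some c"
| "circle_inversion c r (Some z) =
     (if z = c then None else Some (c + of_real (r\<^sup>2) / cnj (z - c)))"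

text \<open>Inversion in a line is the Euclidean reflection.\<close>

fun line_reflection :: "complex \<Rightarrow> complex \<Rightarrow> ext_complex \<Rightarrow> ext_complex" where
  "line_reflection p d None = None"
| "line_reflection p d (Some z) = Some (p + d / cnj d * cnj (z - p))"

definition is_inversion :: "(ext_complex \<Rightarrow> ext_complex) \<Rightarrow> bool" where
  "is_inversion I \<longleftrightarrow>
     (\<exists>c r. r > 0 \<and> I = circle_inversion c r) \<or> (\<exists>p d. d \<noteq> 0 \<and> I = line_reflection p d)"

inductive moebius :: "(ext_complex \<Rightarrow> ext_complex) \<Rightarrow> bool" where
  moebius_id: "moebius id"
| moebius_comp: "is_inversion I \<Longrightarrow> moebius M \<Longrightarrow> moebius (I \<circ> M)"

definition moebius_equivalent :: "(real \<Rightarrow> complex) \<Rightarrow> (real \<Rightarrow> complex) \<Rightarrow> bool" where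
  "moebius_equivalent s t \<longleftrightarrow> (\<exists>M. moebius M \<and> (\<forall>u. M (Some (s u)) = Some (t u)))"

section \<open>Circles attached to a curve\<close>

definition curvature_circle :: "(real \<Rightarrow> complex) \<Rightarrow> real \<Rightarrow> ext_complex set" where
  "curvature_circle s u =
     (if curvature s u = 0 then ext_line (s u) (curve_deriv s u)
      else euclidean_circle (s u + (1 / curvature s u) *\<^sub>R normal_vec s u) (1 / \<bar>curvature s u\<bar>))"

definition s_tilde :: "(real \<Rightarrow> complex) \<Rightarrow> real \<Rightarrow> ext_complex" where
  "s_tilde s u =
     (if curve_deriv (curve_deriv s) u = 0 then None
      else Some (s u - 2 * (curve_deriv s u)\<^sup>2 / curve_deriv (curve_deriv s) u))"

text \<open>For a regular curve this circle exists and is unique, see \<open>orth_circle_unique\<close> below.\<close>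

definition orth_circle :: "(real \<Rightarrow> complex) \<Rightarrow> real \<Rightarrow> ext_complex set" where
  "orth_circle s u = (THE C. is_circle C \<and> circles_orthogonal C (curvature_circle s u) \<and>
                             Some (s u) \<in> C \<and> s_tilde s u \<in> C)"

section \<open>Well-definedness\<close>

lemma Some_in_euclidean_circle: "Some z \<in> euclidean_circle c r \<longleftrightarrow> dist c z = r"
  by (auto simp: euclidean_circle_def)

lemma None_notin_euclidean_circle: "None \<notin> euclidean_circle c r"
  by (auto simp: euclidean_circle_def)

lemma None_in_ext_line: "None \<in> ext_line p d"
  by (auto simp: ext_line_def)

lemma Some_in_ext_line: "Some z \<in> ext_line p d \<longleftrightarrow> (\<exists>t::real. z = p + t *\<^sub>R d)"
  by (auto simp: ext_line_def)

lemma complex_perp_iff: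
  fixes d v :: complex
  assumes "d \<noteq> 0"
  shows "v \<bullet> d = 0 \<longleftrightarrow> (\<exists>t::real. v = t *\<^sub>R (\<i> * d))"
proof
  assume h: "v \<bullet> d = 0"
  define n where "n = (Re d)\<^sup>2 + (Im d)\<^sup>2"
  have n: "n \<noteq> 0" using assms by (simp add: n_def complex_eq_iff sum_power2_eq_zero_iff)
  define t where "t = (Im v * Re d - Re v * Im d) / n"
  have 1: "Re v * Re d + Im v * Im d = 0" using h by (simp add: inner_complex_def)
  have "n * Re v = - (Im v * Re d - Re v * Im d) * Im d"
    using 1 unfolding n_def by algebra
  moreover have "n * Im v = (Im v * Re d - Re v * Im d) * Re d"
    using 1 unfolding n_def by algebra
  ultimately have "v = t *\<^sub>R (\<i> * d)"
    using n by (simp add: complex_eq_iff t_def field_simps)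
  then show "\<exists>t::real. v = t *\<^sub>R (\<i> * d)" ..
qed (auto simp: inner_complex_def)

lemma euclidean_circle_center:
  assumes "r > 0" "r' > 0" "euclidean_circle c r = euclidean_circle c' r'"
  shows "c = c'"
proof -
  have on: "dist c' (c + r *\<^sub>R e) = r'" if "norm e = 1" for e
  proof -
    have "Some (c + r *\<^sub>R e) \<in> euclidean_circle c r"
      using that assms(1) by (simp add: Some_in_euclidean_circle dist_norm)
    then show ?thesis using assms(3) by (simp add: Some_in_euclidean_circle)
  qed
  have sq: "(dist c' z)\<^sup>2 = (Re c' - Re z)\<^sup>2 + (Im c' - Im z)\<^sup>2" for z
    by (simp add: dist_norm cmod_power2)
  have "(Re c' - (Re c + r))\<^sup>2 + (Im c' - Im c)\<^sup>2 = (Re c' - (Re c - r))\<^sup>2 + (Im c' - Im c)\<^sup>2"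
    using on[of 1] on[of "-1"] sq[of "c + r *\<^sub>R 1"] sq[of "c + r *\<^sub>R (-1)"] by simp
  then have 1: "r * (Re c' - Re c) = 0" by algebra
  have "(Re c' - Re c)\<^sup>2 + (Im c' - (Im c + r))\<^sup>2 = (Re c' - Re c)\<^sup>2 + (Im c' - (Im c - r))\<^sup>2"
    using on[of "\<i>"] on[of "-\<i>"] sq[of "c + r *\<^sub>R \<i>"] sq[of "c + r *\<^sub>R (-\<i>)"] by simp
  then have 2: "r * (Im c' - Im c) = 0" by algebra
  show ?thesis using 1 2 assms(1) by (simp add: complex_eq_iff)
qed

lemma ext_line_direction:
  assumes "ext_line p d = ext_line p' d'"
  shows "\<exists>t::real. d = t *\<^sub>R d'"
proof -
  have "Some (p + 0 *\<^sub>R d) \<in> ext_line p d" "Some (p + 1 *\<^sub>R d) \<in> ext_line p d"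
    unfolding Some_in_ext_line by blast+
  then have "\<exists>a::real. p = p' + a *\<^sub>R d'" "\<exists>b::real. p + d = p' + b *\<^sub>R d'"
    unfolding assms Some_in_ext_line by simp_all
  then obtain a b :: real where a: "p = p' + a *\<^sub>R d'" and b: "p + d = p' + b *\<^sub>R d'"
    by blast
  have "d = (p + d) - p" by simp
  also have "\<dots> = (b - a) *\<^sub>R d'" unfolding b by (subst a) (simp add: algebra_simps)
  finally show ?thesis ..
qed

lemma tangent_at_euclidean_circle:
  assumes "r > 0"
  shows "tangent_at (euclidean_circle c r) z v \<longleftrightarrow>
           Some z \<in> euclidean_circle c r \<and> v \<bullet> (z - c) = 0"
  using assms None_in_ext_line None_notin_euclidean_circle
  unfolding tangent_at_def orthogonal_def by (metis euclidean_circle_center)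

lemma tangent_at_ext_line:
  assumes "d \<noteq> 0"
  shows "tangent_at (ext_line p d) z v \<longleftrightarrow>
           Some z \<in> ext_line p d \<and> (\<exists>t::real. v = t *\<^sub>R d)"
proof
  assume "tangent_at (ext_line p d) z v"
  then obtain p' d' t where "Some z \<in> ext_line p d" "ext_line p d = ext_line p' d'" 
      "v = t *\<^sub>R d'"
    unfolding tangent_at_def using None_in_ext_line None_notin_euclidean_circle by metis
  then show "Some z \<in> ext_line p d \<and> (\<exists>t::real. v = t *\<^sub>R d)"
    by (metis ext_line_direction scaleR_scaleR)
next
  assume "Some z \<in> ext_line p d \<and> (\<exists>t::real. v = t *\<^sub>R d)"
  then show "tangent_at (ext_line p d) z v"
    unfolding tangent_at_def using assms by blast
qed

text \<open>The circles through a finite point \<open>a\<close> are the zero sets of the functions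
  \<open>A |z - a|\<^sup>2 + B \<bullet> (z - a)\<close> with \<open>B \<noteq> 0\<close>.\<close>

definition pencil :: "complex \<Rightarrow> real \<Rightarrow> complex \<Rightarrow> ext_complex set" where
  "pencil a A B = {x. case x of None \<Rightarrow> A = 0
                     | Some z \<Rightarrow> A * ((z - a) \<bullet> (z - a)) + B \<bullet> (z - a) = 0}"

lemma in_pencil:
  "None \<in> pencil a A B \<longleftrightarrow> A = 0"
  "Some z \<in> pencil a A B \<longleftrightarrow> A * ((z - a) \<bullet> (z - a)) + B \<bullet> (z - a) = 0"
  by (auto simp: pencil_def)

lemma pencil_scale: "k \<noteq> 0 \<Longrightarrow> pencil a (k * A) (k *\<^sub>R B) = pencil a A B"
proof -
  assume k: "k \<noteq> 0"
  have "k * A * x + k * y = 0 \<longleftrightarrow> A * x + y = 0" for x y :: real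
    using k by (simp add: mult.assoc flip: distrib_left)
  then show ?thesis using k by (auto simp: pencil_def split: option.splits)
qed

lemma ext_line_eq_pencil:
  assumes "d \<noteq> 0"
  shows "ext_line a d = pencil a 0 (\<i> * d)"
proof (rule set_eqI)
  fix x
  have "Some z \<in> ext_line a d \<longleftrightarrow> Some z \<in> pencil a 0 (\<i> * d)" for z
  proof -
    have "Some z \<in> pencil a 0 (\<i> * d) \<longleftrightarrow> (\<exists>t::real. z - a = t *\<^sub>R (\<i> * (\<i> * d)))"
      using assms complex_perp_iff[of "\<i> * d" "z - a"] by (simp add: in_pencil inner_commute)
    also have "\<dots> \<longleftrightarrow> (\<exists>t::real. z = a + t *\<^sub>R d)"
    proof
      assume "\<exists>t::real. z - a = t *\<^sub>R (\<i> * (\<i> * d))"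
      then obtain t :: real where "z - a = t *\<^sub>R (\<i> * (\<i> * d))" ..
      then have "z = a + (- t) *\<^sub>R d" by (simp add: complex_eq_iff)
      then show "\<exists>t::real. z = a + t *\<^sub>R d" ..
    next
      assume "\<exists>t::real. z = a + t *\<^sub>R d"
      then obtain t :: real where "z = a + t *\<^sub>R d" ..
      then have "z - a = (- t) *\<^sub>R (\<i> * (\<i> * d))" by (simp add: complex_eq_iff)
      then show "\<exists>t::real. z - a = t *\<^sub>R (\<i> * (\<i> * d))" ..
    qed
    finally show ?thesis by (simp add: Some_in_ext_line)
  qed
  then show "x \<in> ext_line a d \<longleftrightarrow> x \<in> pencil a 0 (\<i> * d)"
    by (cases x) (auto simp: None_in_ext_line in_pencil)
qed

lemma euclidean_circle_eq_pencil:
  assumes "Some a \<in> euclidean_circle c r"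
  shows "euclidean_circle c r = pencil a 1 (2 *\<^sub>R (a - c))"
proof (rule set_eqI)
  fix x
  have "Some z \<in> euclidean_circle c r \<longleftrightarrow> Some z \<in> pencil a 1 (2 *\<^sub>R (a - c))" for z
  proof -
    have "Some z \<in> euclidean_circle c r \<longleftrightarrow> dist c z = dist c a"
      using assms by (simp add: Some_in_euclidean_circle)
    also have "\<dots> \<longleftrightarrow> (c - z) \<bullet> (c - z) = (c - a) \<bullet> (c - a)"
      by (simp add: dist_norm norm_eq)
    also have "\<dots> \<longleftrightarrow> (z - a) \<bullet> (z - a) + 2 * ((a - c) \<bullet> (z - a)) = 0"
      by (simp add: inner_complex_def) argo
    finally show ?thesis by (simp add: in_pencil)
  qed
  then show "x \<in> euclidean_circle c r \<longleftrightarrow> x \<in> pencil a 1 (2 *\<^sub>R (a - c))"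
    by (cases x) (auto simp: None_notin_euclidean_circle in_pencil)
qed

lemma is_circle_imp_pencil:
  assumes "is_circle C" "Some a \<in> C"
  obtains A B where "B \<noteq> 0" "C = pencil a A B"
proof -
  consider (circ) c r where "r > 0" "C = euclidean_circle c r"
    | (line) p d where "d \<noteq> 0" "C = ext_line p d"
    using assms(1) unfolding is_circle_def by blast
  then show thesis
  proof cases
    case circ
    then have "a \<noteq> c" using assms(2) by (auto simp: Some_in_euclidean_circle)
    then show thesis using that[of "2 *\<^sub>R (a - c)" 1] circ euclidean_circle_eq_pencil assms(2) by auto
  next
    case line
    then obtain t where a: "a = p + t *\<^sub>R d" using assms(2) by (auto simp: Some_in_ext_line)
    have "(\<exists>r. z = p + r *\<^sub>R d) \<longleftrightarrow> (\<exists>r. z = a + r *\<^sub>R d)" for z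
    proof
      assume "\<exists>r. z = p + r *\<^sub>R d"
      then obtain r where "z = p + r *\<^sub>R d" ..
      then have "z = a + (r - t) *\<^sub>R d" by (simp add: a algebra_simps)
      then show "\<exists>r. z = a + r *\<^sub>R d" ..
    next
      assume "\<exists>r. z = a + r *\<^sub>R d"
      then obtain r where "z = a + r *\<^sub>R d" ..
      then have "z = p + (t + r) *\<^sub>R d" by (simp add: a algebra_simps)
      then show "\<exists>r. z = p + r *\<^sub>R d" ..
    qed
    then have "range (\<lambda>r. p + r *\<^sub>R d) = range (\<lambda>r. a + r *\<^sub>R d)" by (auto simp: set_eq_iff)
    then have "C = ext_line a d" by (simp add: line ext_line_def)
    then show thesis using that[of "\<i> * d" 0] line ext_line_eq_pencil by simp
  qed
qed

lemma pencil_cases: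
  assumes "B \<noteq> 0"
  obtains (line) "A = 0" "pencil a A B = ext_line a (- \<i> * B)"
  | (circ) c r where "A \<noteq> 0" "r > 0" "c = a - (1 / (2 * A)) *\<^sub>R B"
      "pencil a A B = euclidean_circle c r"
proof (cases "A = 0")
  case True
  then show thesis using line ext_line_eq_pencil[of "- \<i> * B" a] assms by (simp add: mult.assoc[symmetric])
next
  case False
  define c where "c = a - (1 / (2 * A)) *\<^sub>R B"
  define r where "r = dist c a"
  have r: "r > 0" using assms False by (simp add: r_def c_def)
  have "euclidean_circle c r = pencil a 1 (2 *\<^sub>R (a - c))"
    by (rule euclidean_circle_eq_pencil) (simp add: Some_in_euclidean_circle r_def)
  also have "\<dots> = pencil a (A * 1) (A *\<^sub>R (2 *\<^sub>R (a - c)))"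
    by (rule pencil_scale[OF False, symmetric])
  also have "\<dots> = pencil a A B" using False by (simp add: c_def)
  finally show thesis using circ[of r c] False r c_def by simp
qed

lemma is_circle_pencil:
  assumes "B \<noteq> 0"
  shows "is_circle (pencil a A B)"
  using assms
proof (cases rule: pencil_cases[of B A a])
  case line
  moreover have "- \<i> * B \<noteq> 0" using assms by simp
  ultimately show ?thesis unfolding is_circle_def by blast
next
  case (circ c r)
  then show ?thesis unfolding is_circle_def by blast
qed

lemma tangent_at_pencil:
  assumes "B \<noteq> 0"
  shows "tangent_at (pencil a A B) z v \<longleftrightarrow>
           Some z \<in> pencil a A B \<and> v \<bullet> ((2 * A) *\<^sub>R (z - a) + B) = 0"
  using assms
proof (cases rule: pencil_cases[of B A a])
  case line
  have "(\<exists>t::real. v = t *\<^sub>R (- \<i> * B)) \<longleftrightarrow> v \<bullet> B = 0"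
    using complex_perp_iff[of "- B" v] assms by simp
  then show ?thesis using line assms tangent_at_ext_line[of "- \<i> * B" a z v] by simp
next
  case (circ c r)
  have "(2 * A) *\<^sub>R (z - a) + B = (2 * A) *\<^sub>R (z - c)"
    using circ(1) by (simp add: circ(3) scaleR_right_distrib scaleR_right_diff_distrib)
  then show ?thesis using circ tangent_at_euclidean_circle[OF circ(2), of c z v] by simp
qed

lemma perp_all_iff:
  fixes g h :: complex
  assumes "g \<noteq> 0" "h \<noteq> 0"
  shows "(\<forall>v w. v \<bullet> g = 0 \<longrightarrow> w \<bullet> h = 0 \<longrightarrow> v \<bullet> w = 0) \<longleftrightarrow> g \<bullet> h = 0"
proof -
  have ii: "(s *\<^sub>R (\<i> * g)) \<bullet> (t *\<^sub>R (\<i> * h)) = s * t * (g \<bullet> h)" for s t :: real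
    by (simp add: inner_complex_def algebra_simps)
  show ?thesis
  proof
    assume *: "\<forall>v w. v \<bullet> g = 0 \<longrightarrow> w \<bullet> h = 0 \<longrightarrow> v \<bullet> w = 0"
    have "(\<i> * g) \<bullet> g = 0" "(\<i> * h) \<bullet> h = 0" by (simp_all add: inner_complex_def)
    then have "(\<i> * g) \<bullet> (\<i> * h) = 0" by (rule *[rule_format])
    then show "g \<bullet> h = 0" using ii[of 1 1] by simp
  next
    assume gh: "g \<bullet> h = 0"
    show "\<forall>v w. v \<bullet> g = 0 \<longrightarrow> w \<bullet> h = 0 \<longrightarrow> v \<bullet> w = 0"
    proof (intro allI impI)
      fix v w :: complex
      assume "v \<bullet> g = 0" "w \<bullet> h = 0"
      then obtain x y :: real where "v = x *\<^sub>R (\<i> * g)" "w = y *\<^sub>R (\<i> * h)"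
        unfolding complex_perp_iff[OF assms(1)] complex_perp_iff[OF assms(2)] by blast
      then show "v \<bullet> w = 0" using ii[of x y] gh by simp
    qed
  qed
qed

lemma circles_orthogonal_pencil:
  assumes "B \<noteq> 0" "B' \<noteq> 0"
  shows "circles_orthogonal (pencil a A B) (pencil a A' B') \<longleftrightarrow> B \<bullet> B' = 0"
proof -
  let ?C = "pencil a A B" and ?D = "pencil a A' B'"
  have grad: "(2 * A) *\<^sub>R w + B \<noteq> 0" if "A * (w \<bullet> w) + B \<bullet> w = 0" "B \<noteq> 0" for A w and B :: complex
  proof
    assume "(2 * A) *\<^sub>R w + B = 0"
    then have "B = - ((2 * A) *\<^sub>R w)" by (simp add: add_eq_0_iff)
    then show False using that by auto
  qed
  have gg: "((2 * A) *\<^sub>R w + B) \<bullet> ((2 * A') *\<^sub>R w + B') = B \<bullet> B'"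
    if "A * (w \<bullet> w) + B \<bullet> w = 0" "A' * (w \<bullet> w) + B' \<bullet> w = 0" for w
  proof -
    have "((2 * A) *\<^sub>R w + B) \<bullet> ((2 * A') *\<^sub>R w + B') =
        2 * A' * (A * (w \<bullet> w) + B \<bullet> w) + 2 * A * (A' * (w \<bullet> w) + B' \<bullet> w) + B \<bullet> B'"
      by (simp add: inner_complex_def algebra_simps)
    then show ?thesis using that by simp
  qed
  have "(\<forall>v w. tangent_at ?C z v \<longrightarrow> tangent_at ?D z w \<longrightarrow> orthogonal v w) \<longleftrightarrow> B \<bullet> B' = 0"
    if "Some z \<in> ?C \<inter> ?D" for z
    using that perp_all_iff[OF grad grad, of A "z - a" B A' "z - a" B'] assms gg[of "z - a"]
    by (simp add: tangent_at_pencil orthogonal_def in_pencil)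
  moreover have "Some a \<in> ?C \<inter> ?D" by (simp add: in_pencil)
  ultimately show ?thesis unfolding circles_orthogonal_def by blast
qed

lemma orthogonal_circle_ex1:
  assumes "is_circle K" "Some a \<in> K" "b \<noteq> Some a"
  shows "\<exists>!C. is_circle C \<and> circles_orthogonal C K \<and> Some a \<in> C \<and> b \<in> C"
proof -
  obtain A' B' where K: "B' \<noteq> 0" "K = pencil a A' B'"
    using is_circle_imp_pencil assms(1,2) by blast
  define n where "n = \<i> * B'"
  have n: "n \<noteq> 0" "n \<bullet> B' = 0" using K by (auto simp: n_def inner_complex_def)
  define A where "A = (case b of None \<Rightarrow> 0 | Some z \<Rightarrow> - (n \<bullet> (z - a)) / ((z - a) \<bullet> (z - a)))"
  have b: "b \<in> pencil a E n \<longleftrightarrow> E = A" for E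
    using assms(3) by (cases b) (auto simp: in_pencil A_def field_simps add_eq_0_iff)
  show ?thesis
  proof (rule ex1I[of _ "pencil a A n"])
    show "is_circle (pencil a A n) \<and> circles_orthogonal (pencil a A n) K \<and>
            Some a \<in> pencil a A n \<and> b \<in> pencil a A n"
      using n K b by (simp add: is_circle_pencil circles_orthogonal_pencil in_pencil)
  next
    fix C assume C: "is_circle C \<and> circles_orthogonal C K \<and> Some a \<in> C \<and> b \<in> C"
    obtain E F where EF: "F \<noteq> 0" "C = pencil a E F"
      using is_circle_imp_pencil C by blast
    then have "F \<bullet> B' = 0" using C K circles_orthogonal_pencil by blast
    then obtain t :: real where t: "F = t *\<^sub>R n"
      using complex_perp_iff[OF K(1)] n_def by auto
    then have t0: "t \<noteq> 0" using EF by auto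
    have "C = pencil a (t * (E / t)) (t *\<^sub>R n)" using EF t t0 by simp
    then have "C = pencil a (E / t) n" using pencil_scale[OF t0] by (rule trans)
    moreover from this have "E / t = A" using C b by blast
    ultimately show "C = pencil a A n" by simp
  qed
qed

lemma orth_circle_unique:
  assumes "regular_curve s"
  shows "\<exists>!C. is_circle C \<and> circles_orthogonal C (curvature_circle s u) \<and>
              Some (s u) \<in> C \<and> s_tilde s u \<in> C"
proof (rule orthogonal_circle_ex1)
  have s': "curve_deriv s u \<noteq> 0" using assms by (simp add: regular_curve_def)
  show "is_circle (curvature_circle s u)"
  proof (cases "curvature s u = 0")
    case True
    then show ?thesis using s' unfolding curvature_circle_def is_circle_def by auto
  next
    case False
    then have "1 / \<bar>curvature s u\<bar> > 0" by simp
    with False show ?thesis unfolding curvature_circle_def is_circle_def if_not_P[OF False] by blast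
  qed
  have "norm (normal_vec s u) = 1" using s' by (simp add: normal_vec_def norm_mult norm_divide)
  then show "Some (s u) \<in> curvature_circle s u"
    by (auto simp: curvature_circle_def Some_in_euclidean_circle Some_in_ext_line dist_norm
        intro: exI[of _ 0])
  show "s_tilde s u \<noteq> Some (s u)" using s' by (simp add: s_tilde_def)
qed

end

theory Submission
  imports Defs
begin

text \<open>
  Embed the extended plane into pairs of homogeneous coordinates, \<open>z \<mapsto> (z, 1)\<close> and
  \<open>\<infinity> \<mapsto> (1, 0)\<close>, and let \<open>h(x, y)\<close> be the modulus of the determinant of two such pairs
  (\<open>hdist\<close> below): the usual distance for finite points, \<open>1\<close> between a finite point and \<open>\<infinity>\<close>.
  Both sides of the equivalence turn out to say that, for some point \<open>p\<close> and some \<open>c > 0\<close>,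

    \<open>h(s(u), p)\<^sup>2 = c |s'(u)|\<close>  for all \<open>u\<close>.    (\<open>*\<close>)

  On the side of the circles, \<open>C(u)\<close> consists of the \<open>z\<close> with
  \<open>\<langle>s', s''\<rangle> |z - s|\<^sup>2 + 2 |s'|\<^sup>2 \<langle>s', z - s\<rangle> = 0\<close>, together with \<open>\<infinity>\<close> if \<open>\<langle>s', s''\<rangle> = 0\<close>
  (lemma \<open>orth_circle_eq_pencil\<close>). Up to the factor \<open>- 1 / |s'|\<^sup>3\<close> the left-hand side, evaluated
  at \<open>z = p\<close> (or \<open>\<langle>s', s''\<rangle>\<close> itself, if \<open>p = \<infinity>\<close>), is the derivative of
  \<open>h(s(u), p)\<^sup>2 / |s'(u)|\<close>. Hence \<open>p\<close> lies on all the circles iff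
  this quotient is constant. The constant cannot be \<open>0\<close>, because \<open>s\<close> would then be constant.
  Since the quotient is differentiable even where \<open>s(u) = p\<close>, this also shows that a common
  point never lies on the curve.

  On the side of Moebius transformations, every \<open>M\<close> satisfies
  \<open>h(M x, M y) = \<lambda>(x) \<lambda>(y) h(x, y)\<close> for a positive function \<open>\<lambda>\<close>, since an inversion does. With
  \<open>M p = \<infinity>\<close> and \<open>y = p\<close> this reads \<open>\<lambda>(x) = 1 / (\<lambda>(p) h(x, p))\<close> wherever \<open>M x\<close> is finite, and
  passing from difference quotients to derivatives, the speed of \<open>t = M \<circ> s\<close> is
  \<open>|s'| / (\<lambda>(p) h(s, p))\<^sup>2\<close>. It equals \<open>1\<close> iff (\<open>*\<close>) holds with \<open>c = 1 / \<lambda>(p)\<^sup>2\<close>.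
  Conversely, (\<open>*\<close>) makes the image of \<open>s\<close> under the inversion in the circle with center \<open>p\<close> and
  radius \<open>\<surd>c\<close> (for \<open>p = \<infinity>\<close>: under scaling by \<open>c\<close>) a curve of unit speed.
\<close>

section \<open>Smooth curves\<close>

lemma smooth_curve_has_vector_derivative:
  assumes "smooth_curve f"
  shows "(f has_vector_derivative curve_deriv f u) (at u)"
proof -
  have "(curve_deriv ^^ 0) f differentiable (at u)"
    using assms unfolding smooth_curve_def by blast
  then show ?thesis by (simp add: curve_deriv_def vector_derivative_works)
qed

lemma smooth_curve_curve_deriv:
  assumes "smooth_curve f"
  shows "smooth_curve (curve_deriv f)"
  unfolding smooth_curve_def
proof (intro allI)
  fix n u
  have "(curve_deriv ^^ Suc n) f differentiable (at u)"
    using assms unfolding smooth_curve_def by blast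
  then show "(curve_deriv ^^ n) (curve_deriv f) differentiable (at u)"
    by (simp add: funpow_swap1)
qed

text \<open>Smoothness is the largest property that passes from a function to its derivative. This
  avoids formulas for higher derivatives: it suffices to find a class of functions, containing the
  given one, that is closed under differentiation.\<close>

lemma smooth_curve_coinduct:
  assumes "P f"
    and step: "\<And>g. P g \<Longrightarrow> \<exists>g'. P g' \<and> (\<forall>u. (g has_vector_derivative g' u) (at u))"
  shows "smooth_curve f"
proof -
  have diff: "P (curve_deriv g) \<and> (\<forall>u. g differentiable (at u))" if g: "P g" for g
  proof -
    obtain g' where g': "P g'" "\<forall>u. (g has_vector_derivative g' u) (at u)"
      using step[OF g] by blast
    then have "curve_deriv g = g'"
      by (auto simp: curve_deriv_def vector_derivative_at)
    with g' show ?thesis by (auto intro: differentiableI_vector)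
  qed
  have "P ((curve_deriv ^^ n) f)" for n
    by (induction n) (auto simp: assms(1) diff)
  then show ?thesis using diff unfolding smooth_curve_def by blast
qed

lemma smooth_curve_const: "smooth_curve (\<lambda>_. c)"
  by (rule smooth_curve_coinduct[where P = "\<lambda>f. \<exists>c. f = (\<lambda>_. c)"])
    (auto intro!: exI[of _ "\<lambda>_. 0"])

lemma smooth_curve_bounded_linear:
  assumes "smooth_curve f" "bounded_linear L"
  shows "smooth_curve (\<lambda>u. L (f u))"
proof (rule smooth_curve_coinduct[where P = "\<lambda>g. \<exists>f. smooth_curve f \<and> g = (\<lambda>u. L (f u))"])
  fix g assume "\<exists>f. smooth_curve f \<and> g = (\<lambda>u. L (f u))"
  then obtain f where f: "smooth_curve f" "g = (\<lambda>u. L (f u))" by blast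
  have "(g has_vector_derivative L (curve_deriv f u)) (at u)" for u
    unfolding f(2) using assms(2) smooth_curve_has_vector_derivative[OF f(1)]
    by (rule bounded_linear.has_vector_derivative)
  then show "\<exists>g'. (\<exists>f. smooth_curve f \<and> g' = (\<lambda>u. L (f u))) \<and>
      (\<forall>u. (g has_vector_derivative g' u) (at u))"
    using smooth_curve_curve_deriv[OF f(1)] by blast
qed (use assms(1) in blast)

inductive smooth_polynomial :: "(real \<Rightarrow> complex) \<Rightarrow> (real \<Rightarrow> complex) \<Rightarrow> bool" for q where
  coeff: "smooth_curve f \<Longrightarrow> smooth_polynomial q f"
| var: "smooth_polynomial q q"
| add: "smooth_polynomial q f \<Longrightarrow> smooth_polynomial q g \<Longrightarrow> smooth_polynomial q (\<lambda>u. f u + g u)"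
| mult: "smooth_polynomial q f \<Longrightarrow> smooth_polynomial q g \<Longrightarrow> smooth_polynomial q (\<lambda>u. f u * g u)"

text \<open>The polynomials in \<open>q\<close> with smooth coefficients are closed under differentiation as soon as
  they contain the derivative of \<open>q\<close>.\<close>

lemma smooth_curve_polynomial_ode:
  assumes q': "\<And>u. (q has_vector_derivative q' u) (at u)" and "smooth_polynomial q q'"
  shows "smooth_curve q"
proof (rule smooth_curve_coinduct[where P = "smooth_polynomial q"])
  fix f assume "smooth_polynomial q f"
  then show "\<exists>f'. smooth_polynomial q f' \<and> (\<forall>u. (f has_vector_derivative f' u) (at u))"
  proof induction
    case (coeff f)
    then show ?case
      using smooth_curve_curve_deriv smooth_curve_has_vector_derivative
        smooth_polynomial.coeff by blast
  next
    case var
    then show ?case using assms by blast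
  next
    case (add f g)
    then obtain f' g' where "smooth_polynomial q f'" "smooth_polynomial q g'"
      and d: "\<And>u. (f has_vector_derivative f' u) (at u)"
        "\<And>u. (g has_vector_derivative g' u) (at u)" by blast
    then have "smooth_polynomial q (\<lambda>u. f' u + g' u)" by (intro smooth_polynomial.add)
    moreover have "((\<lambda>u. f u + g u) has_vector_derivative f' u + g' u) (at u)" for u
      by (intro has_vector_derivative_add d)
    ultimately show ?case by blast
  next
    case (mult f g)
    then obtain f' g' where "smooth_polynomial q f'" "smooth_polynomial q g'"
      and d: "\<And>u. (f has_vector_derivative f' u) (at u)"
        "\<And>u. (g has_vector_derivative g' u) (at u)" by blast
    with mult.hyps have "smooth_polynomial q (\<lambda>u. f u * g' u + f' u * g u)"
      by (intro smooth_polynomial.add smooth_polynomial.mult)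
    moreover have "((\<lambda>u. f u * g u) has_vector_derivative f u * g' u + f' u * g u) (at u)" for u
      by (intro has_vector_derivative_mult d)
    ultimately show ?case by blast
  qed
qed (rule smooth_polynomial.var)

lemma has_vector_derivative_inversion:
  assumes "(s has_vector_derivative s') (at u)" "s u \<noteq> p"
  shows "((\<lambda>u. p + of_real R / cnj (s u - p)) has_vector_derivative
           - (of_real R * cnj s' / (cnj (s u - p))\<^sup>2)) (at u)"
proof -
  have "((\<lambda>u. cnj (s u - p)) has_vector_derivative cnj s') (at u)"
    using bounded_linear.has_vector_derivative[OF bounded_linear_cnj
        has_vector_derivative_diff[OF assms(1) has_vector_derivative_const[of p]]] by simp
  moreover have "((\<lambda>z. p + of_real R / z) has_field_derivative
      - (of_real R / (cnj (s u - p))\<^sup>2)) (at (cnj (s u - p)))"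
    using assms(2) by (auto intro!: derivative_eq_intros simp: power2_eq_square)
  ultimately show ?thesis
    using field_vector_diff_chain_at[of "\<lambda>u. cnj (s u - p)" "cnj s'" u
        "\<lambda>z. p + of_real R / z" "- (of_real R / (cnj (s u - p))\<^sup>2)"]
    by (simp add: o_def mult.commute)
qed

text \<open>The inverted curve \<open>t\<close> solves \<open>t' = a (t - p)\<^sup>2\<close> with the smooth coefficient
  \<open>a = - cnj s' / R\<close>.\<close>

lemma smooth_curve_inversion:
  assumes "smooth_curve s" "\<And>u. s u \<noteq> p" "R \<noteq> 0"
  shows "smooth_curve (\<lambda>u. p + of_real R / cnj (s u - p))" (is "smooth_curve ?t")
proof (rule smooth_curve_polynomial_ode)
  let ?a = "\<lambda>u. (- 1 / R) *\<^sub>R cnj (curve_deriv s u)"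
  let ?t' = "\<lambda>u. ?a u * ((?t u + (- p)) * (?t u + (- p)))"
  show "(?t has_vector_derivative ?t' u) (at u)" for u
  proof -
    have "?t' u = - (of_real R * cnj (curve_deriv s u) / (cnj (s u - p))\<^sup>2)"
      using assms(2)[of u] assms(3)
      by (simp add: scaleR_conv_of_real field_simps power2_eq_square)
    then show ?thesis
      by (simp only:) (intro has_vector_derivative_inversion
          smooth_curve_has_vector_derivative assms(1,2))
  qed
  have "bounded_linear (\<lambda>z. (- 1 / R) *\<^sub>R cnj z)"
    by (rule bounded_linear_compose[OF bounded_linear_scaleR_right bounded_linear_cnj])
  then have "smooth_curve ?a"
    by (rule smooth_curve_bounded_linear[OF smooth_curve_curve_deriv[OF assms(1)]])
  then show "smooth_polynomial ?t ?t'"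
    by (intro smooth_polynomial.intros smooth_curve_const)
qed

section \<open>Moebius transformations and the homogeneous distance\<close>

text \<open>The modulus of the determinant of the homogeneous coordinates \<open>(z, 1)\<close> of finite points and
  \<open>(1, 0)\<close> of the point at infinity.\<close>

fun hdist :: "ext_complex \<Rightarrow> ext_complex \<Rightarrow> real" where
  "hdist None None = 0"
| "hdist None (Some w) = 1"
| "hdist (Some z) None = 1"
| "hdist (Some z) (Some w) = dist z w"

lemma dist_circle_inversion:
  assumes "z \<noteq> c" "w \<noteq> c"
  shows "dist (c + of_real (r\<^sup>2) / cnj (z - c)) (c + of_real (r\<^sup>2) / cnj (w - c)) =
           r\<^sup>2 * dist z w / (dist z c * dist w c)"
proof -
  have "(c + of_real (r\<^sup>2) / cnj (z - c)) - (c + of_real (r\<^sup>2) / cnj (w - c)) =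
      of_real (r\<^sup>2) * cnj (w - z) / (cnj (z - c) * cnj (w - c))"
    using assms by (simp add: field_simps)
  then have "norm ((c + of_real (r\<^sup>2) / cnj (z - c)) - (c + of_real (r\<^sup>2) / cnj (w - c))) =
      r\<^sup>2 * norm (w - z) / (norm (z - c) * norm (w - c))"
    by (simp only: norm_mult norm_divide complex_mod_cnj norm_of_real abs_power2)
  then show ?thesis by (simp add: dist_norm norm_minus_commute)
qed

lemma hdist_circle_inversion:
  fixes c :: complex and r :: real
  assumes "r > 0"
  defines "lam \<equiv> (\<lambda>x. case x of None \<Rightarrow> r
    | Some z \<Rightarrow> if z = c then 1 / r else r / dist z c)"
  shows "hdist (circle_inversion c r x) (circle_inversion c r y) = lam x * lam y * hdist x y"
proof -
  define J where "J z = c + of_real (r\<^sup>2) / cnj (z - c)" for z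
  have I: "circle_inversion c r (Some z) = (if z = c then None else Some (J z))" for z
    by (simp add: J_def)
  have center: "dist c (J z) = r\<^sup>2 / dist z c" for z
    by (simp add: J_def dist_norm norm_divide norm_power del: complex_cnj_diff)
  have J: "dist (J z) (J w) = r\<^sup>2 * dist z w / (dist z c * dist w c)" if "z \<noteq> c" "w \<noteq> c" for z w
    unfolding J_def using that by (rule dist_circle_inversion)
  show ?thesis
    using assms(1)
    by (cases x; cases y)
      (auto simp: lam_def I J center dist_commute[of _ c] power2_eq_square
        simp del: circle_inversion.simps(2))
qed

lemma hdist_line_reflection:
  assumes "d \<noteq> 0"
  shows "hdist (line_reflection p d x) (line_reflection p d y) = hdist x y"
proof -
  have "dist (p + d / cnj d * cnj (z - p)) (p + d / cnj d * cnj (w - p)) = dist z w" for z w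
  proof -
    have "(p + d / cnj d * cnj (z - p)) - (p + d / cnj d * cnj (w - p)) = d / cnj d * cnj (z - w)"
      by (simp add: algebra_simps flip: diff_divide_distrib)
    then have "norm ((p + d / cnj d * cnj (z - p)) - (p + d / cnj d * cnj (w - p))) = norm (z - w)"
      using assms by (simp only: norm_mult norm_divide complex_mod_cnj) simp
    then show ?thesis by (simp add: dist_norm)
  qed
  then show ?thesis by (cases x; cases y) simp_all
qed

lemma inversion_involution:
  assumes "is_inversion I"
  shows "I (I x) = x"
  using assms unfolding is_inversion_def
proof (elim disjE exE conjE)
  fix c r assume "(r::real) > 0" "I = circle_inversion c r"
  then show ?thesis by (cases x) auto
next
  fix p d :: complex assume "d \<noteq> 0" "I = line_reflection p d"
  then show ?thesis by (cases x) auto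
qed

lemma moebius_surj:
  assumes "moebius M"
  shows "surj M"
  using assms
proof induction
  case (moebius_comp I M)
  have "surj I" using inversion_involution[OF moebius_comp.hyps(1)] by (rule surjI)
  with moebius_comp.IH show ?case by (rule comp_surj)
qed simp

lemma moebius_hdist:
  assumes "moebius M"
  shows "\<exists>lam. (\<forall>x. lam x > 0) \<and> (\<forall>x y. hdist (M x) (M y) = lam x * lam y * hdist x y)"
  using assms
proof induction
  case moebius_id
  show ?case by (rule exI[of _ "\<lambda>_. 1"]) simp
next
  case (moebius_comp I M)
  have "\<exists>mu. (\<forall>x. mu x > 0) \<and> (\<forall>x y. hdist (I x) (I y) = mu x * mu y * hdist x y)"
    using moebius_comp.hyps(1) unfolding is_inversion_def
  proof (elim disjE exE conjE)
    fix c r assume "(r::real) > 0" "I = circle_inversion c r"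
    then show ?thesis
      by (intro exI[of _ "\<lambda>x. case x of None \<Rightarrow> r
            | Some z \<Rightarrow> if z = c then 1 / r else r / dist z c"])
        (auto simp: hdist_circle_inversion split: option.split)
  next
    fix p d :: complex assume "d \<noteq> 0" "I = line_reflection p d"
    then show ?thesis by (intro exI[of _ "\<lambda>_. 1"]) (simp add: hdist_line_reflection)
  qed
  then obtain mu where mu: "\<And>x. mu x > 0" "\<And>x y. hdist (I x) (I y) = mu x * mu y * hdist x y"
    by blast
  obtain lam where lam: "\<And>x. lam x > 0" "\<And>x y. hdist (M x) (M y) = lam x * lam y * hdist x y"
    using moebius_comp.IH by blast
  show ?case
    by (rule exI[of _ "\<lambda>x. mu (M x) * lam x"]) (simp add: mu lam)
qed

text \<open>The factor \<open>\<lambda>\<close> of the previous lemma is determined by the point \<open>p\<close> that is sent to infinity: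
  inserting \<open>y = p\<close> gives \<open>1 = \<lambda>(x) \<lambda>(p) h(x, p)\<close> for every \<open>x\<close> with finite image.\<close>

lemma moebius_distance_distortion:
  assumes "moebius M"
  obtains p K where "K > 0"
    "\<And>z w z' w'. M (Some z) = Some z' \<Longrightarrow> M (Some w) = Some w' \<Longrightarrow>
       dist z w = K * hdist (Some z) p * hdist (Some w) p * dist z' w'"
proof -
  obtain lam where lam: "\<And>x. lam x > 0" "\<And>x y. hdist (M x) (M y) = lam x * lam y * hdist x y"
    using moebius_hdist[OF assms] by blast
  obtain p where p: "M p = None" using moebius_surj[OF assms] by (metis surjD)
  have one: "lam (Some z) * lam p * hdist (Some z) p = 1" if "M (Some z) = Some z'" for z z'
    using lam(2)[of "Some z" p] p that by simp
  show thesis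
  proof (rule that[of "(lam p)\<^sup>2" p])
    show "(lam p)\<^sup>2 > 0" using lam(1)[of p] by simp
    fix z w z' w' assume im: "M (Some z) = Some z'" "M (Some w) = Some w'"
    have "(lam p)\<^sup>2 * hdist (Some z) p * hdist (Some w) p * dist z' w' =
        (lam (Some z) * lam p * hdist (Some z) p) * (lam (Some w) * lam p * hdist (Some w) p) *
          dist z w"
      using lam(2)[of "Some z" "Some w"] im by (simp add: power2_eq_square)
    then show "dist z w = (lam p)\<^sup>2 * hdist (Some z) p * hdist (Some w) p * dist z' w'"
      by (simp only: one[OF im(1)] one[OF im(2)])
  qed
qed

lemma has_vector_derivative_dist_quotient:
  assumes "(f has_vector_derivative f') (at u)"
  shows "((\<lambda>x. dist (f x) (f u) / \<bar>x - u\<bar>) \<longlongrightarrow> norm f') (at u)"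
proof -
  let ?q = "\<lambda>x. (f x - f u) /\<^sub>R (x - u)"
  have "((\<lambda>x. norm (f x - f u - (x - u) *\<^sub>R f') / norm (x - u)) \<longlongrightarrow> 0) (at u)"
    using assms unfolding has_vector_derivative_def has_derivative_iff_norm by blast
  moreover have "norm (f x - f u - (x - u) *\<^sub>R f') / norm (x - u) = norm (?q x - f')"
    if "x \<noteq> u" for x
  proof -
    have "?q x - f' = (f x - f u - (x - u) *\<^sub>R f') /\<^sub>R (x - u)"
      using that by (simp add: scaleR_right_diff_distrib)
    then show ?thesis by (simp add: divide_inverse_commute)
  qed
  ultimately have "((\<lambda>x. norm (?q x - f')) \<longlongrightarrow> 0) (at u)"
    by (simp cong: LIM_cong)
  then have "(?q \<longlongrightarrow> f') (at u)"
    by (rule LIM_zero_cancel[OF tendsto_norm_zero_cancel])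
  from tendsto_norm[OF this] show ?thesis
    by (simp add: dist_norm divide_inverse_commute)
qed

lemma continuous_hdist:
  assumes "isCont s u"
  shows "isCont (\<lambda>x. hdist (Some (s x)) p) u"
  using assms by (cases p) (simp_all add: continuous_dist)

text \<open>The infinitesimal form of the distortion formula.\<close>

lemma moebius_equivalent_speed:
  assumes "moebius_equivalent s t"
    and s: "\<And>u. (s has_vector_derivative s' u) (at u)"
    and t: "\<And>u. (t has_vector_derivative t' u) (at u)"
  obtains p K where "K > 0" "\<And>u. norm (s' u) = K * (hdist (Some (s u)) p)\<^sup>2 * norm (t' u)"
proof -
  obtain M where M: "moebius M" "\<And>u. M (Some (s u)) = Some (t u)"
    using assms(1) unfolding moebius_equivalent_def by blast
  obtain p K where K: "K > 0"
    "\<And>z w z' w'. M (Some z) = Some z' \<Longrightarrow> M (Some w) = Some w' \<Longrightarrow>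
       dist z w = K * hdist (Some z) p * hdist (Some w) p * dist z' w'"
    by (rule moebius_distance_distortion[OF M(1)], rule that)
  have "norm (s' u) = K * (hdist (Some (s u)) p)\<^sup>2 * norm (t' u)" for u
  proof -
    let ?e = "\<lambda>x. hdist (Some (s x)) p"
    have "isCont s u" by (rule has_vector_derivative_continuous[OF s])
    then have "(?e \<longlongrightarrow> ?e u) (at u)" using continuous_hdist isCont_def by blast
    then have "((\<lambda>x. K * ?e x * ?e u * (dist (t x) (t u) / \<bar>x - u\<bar>))
        \<longlongrightarrow> K * ?e u * ?e u * norm (t' u)) (at u)"
      by (intro tendsto_mult tendsto_const has_vector_derivative_dist_quotient t)
    moreover have "K * ?e x * ?e u * (dist (t x) (t u) / \<bar>x - u\<bar>) = dist (s x) (s u) / \<bar>x - u\<bar>"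
      for x
      using K(2)[OF M(2)[of x] M(2)[of u]] by simp
    ultimately have "((\<lambda>x. dist (s x) (s u) / \<bar>x - u\<bar>) \<longlongrightarrow> K * ?e u * ?e u * norm (t' u)) (at u)"
      by (simp only:)
    from tendsto_unique[OF _ has_vector_derivative_dist_quotient[OF s] this]
    show ?thesis by (simp add: power2_eq_square mult.assoc)
  qed
  with K(1) show thesis by (rule that)
qed

lemma moebius_inversion:
  assumes "r > 0"
  shows "moebius (circle_inversion c r)"
  using moebius_comp[OF _ moebius_id, of "circle_inversion c r"] assms
  unfolding is_inversion_def by auto

text \<open>A scaling is the composition of the inversions in two concentric circles.\<close>

lemma moebius_equivalent_scaling:
  assumes "c > 0"
  shows "moebius_equivalent s (\<lambda>u. c *\<^sub>R s u)"
proof -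
  have "sqrt c > 0" using assms by simp
  then have "is_inversion (circle_inversion 0 (sqrt c))"
    unfolding is_inversion_def by blast
  moreover have "moebius (circle_inversion 0 1)" by (rule moebius_inversion) simp
  ultimately have "moebius (circle_inversion 0 (sqrt c) \<circ> circle_inversion 0 1)"
    by (rule moebius_comp)
  moreover have "(circle_inversion 0 (sqrt c) \<circ> circle_inversion 0 1) (Some z) = Some (c *\<^sub>R z)" for z
    using assms by (simp add: scaleR_conv_of_real flip: of_real_power)
  ultimately show ?thesis unfolding moebius_equivalent_def by blast
qed

section \<open>The orthogonal circles\<close>

text \<open>The curvature circle is tangent to \<open>s'\<close>, so a circle through \<open>s(u)\<close> is orthogonal to it iff
  its gradient at \<open>s(u)\<close> is a multiple of \<open>s'\<close>. The coefficient of the quadratic term is then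
  fixed by the requirement that \<open>s - 2 s'\<^sup>2 / s''\<close> be a zero.\<close>

lemma orth_circle_eq_pencil:
  assumes "regular_curve s"
  defines "v \<equiv> \<lambda>u. curve_deriv s u" and "w \<equiv> \<lambda>u. curve_deriv (curve_deriv s) u"
  shows "orth_circle s u = pencil (s u) (v u \<bullet> w u) ((2 * (norm (v u))\<^sup>2) *\<^sub>R v u)"
proof -
  let ?B = "(2 * (norm (v u))\<^sup>2) *\<^sub>R v u"
  let ?P = "pencil (s u) (v u \<bullet> w u) ?B"
  have v: "v u \<noteq> 0" using assms(1) by (simp add: regular_curve_def v_def)
  then have B: "?B \<noteq> 0" by simp
  obtain A k where Ak: "k \<noteq> 0" "curvature_circle s u = pencil (s u) A (k *\<^sub>R (\<i> * v u))"
  proof (cases "curvature s u = 0")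
    case True
    then show thesis
      using that[of 1 0] ext_line_eq_pencil[OF v, of "s u"]
      by (simp add: curvature_circle_def v_def)
  next
    case False
    let ?k = "1 / curvature s u"
    let ?c = "s u + ?k *\<^sub>R normal_vec s u"
    have n: "norm (normal_vec s u) = 1"
      using v by (simp add: normal_vec_def norm_mult norm_divide v_def)
    have "curvature_circle s u = euclidean_circle ?c (1 / \<bar>curvature s u\<bar>)"
      using False by (simp add: curvature_circle_def)
    also have "\<dots> = pencil (s u) 1 (2 *\<^sub>R (s u - ?c))"
      by (rule euclidean_circle_eq_pencil) (simp add: Some_in_euclidean_circle dist_norm n)
    also have "2 *\<^sub>R (s u - ?c) = (- 2 * ?k / norm (v u)) *\<^sub>R (\<i> * v u)"
      by (simp add: normal_vec_def v_def scaleR_conv_of_real)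
    finally show thesis using that[of "- 2 * ?k / norm (v u)" 1] False v by simp
  qed
  have orth: "circles_orthogonal ?P (curvature_circle s u)"
  proof -
    have "k *\<^sub>R (\<i> * v u) \<noteq> 0" using Ak(1) v by simp
    moreover have "?B \<bullet> (k *\<^sub>R (\<i> * v u)) = 0" by (simp add: inner_complex_def)
    ultimately show ?thesis unfolding Ak(2) using circles_orthogonal_pencil[OF B] by blast
  qed
  have tilde: "s_tilde s u \<in> ?P"
  proof (cases "w u = 0")
    case True
    then show ?thesis by (simp add: s_tilde_def w_def in_pencil)
  next
    case False
    define z where "z = - (2 * (v u)\<^sup>2 / w u)"
    have zw: "z = - 2 * (v u)\<^sup>2 * cnj (w u) / of_real ((norm (w u))\<^sup>2)"
      unfolding z_def using complex_div_cnj[of "2 * (v u)\<^sup>2" "w u"] by simp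
    have "z \<bullet> z = (norm z)\<^sup>2" by (simp add: dot_square_norm)
    also have "norm z = 2 * (norm (v u))\<^sup>2 / norm (w u)"
      by (simp add: z_def norm_mult norm_divide norm_power)
    finally have zz: "z \<bullet> z = 4 * (norm (v u))^4 / (norm (w u))\<^sup>2"
      by (simp add: power_divide power_mult_distrib)
    have "v u \<bullet> z = Re (cnj (v u) * z)" by (simp add: inner_complex_def)
    also have "cnj (v u) * z = of_real (- 2 * (norm (v u))\<^sup>2 / (norm (w u))\<^sup>2) * (v u * cnj (w u))"
      unfolding zw using complex_norm_square[of "v u"] by (simp add: power2_eq_square)
    also have "Re \<dots> = - 2 * (norm (v u))\<^sup>2 / (norm (w u))\<^sup>2 * (v u \<bullet> w u)"
      by (simp only: scaleR_conv_of_real[symmetric] complex_scaleR) (simp add: inner_complex_def)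
    finally have vz: "v u \<bullet> z = - 2 * (norm (v u))\<^sup>2 / (norm (w u))\<^sup>2 * (v u \<bullet> w u)" .
    have "(v u \<bullet> w u) * (z \<bullet> z) + ?B \<bullet> z = 0"
      unfolding zz inner_scaleR_left vz by (simp add: field_simps power_def numeral_eq_Suc)
    then show ?thesis using False by (simp add: s_tilde_def w_def v_def z_def in_pencil)
  qed
  show ?thesis unfolding orth_circle_def
    by (rule the1_equality[OF orth_circle_unique[OF assms(1)]])
      (use is_circle_pencil[OF B] orth tilde in \<open>simp add: in_pencil\<close>)
qed

text \<open>By the quotient rule, the derivative of the function below is the value at \<open>p\<close> of the
  polynomial that defines the circle, divided by \<open>- |s'|\<^sup>3\<close>.\<close>

lemma in_orth_circle_iff_stationary:
  assumes "smooth_curve s" "regular_curve s"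
  shows "p \<in> orth_circle s u \<longleftrightarrow>
    ((\<lambda>x. (hdist (Some (s x)) p)\<^sup>2 / norm (curve_deriv s x)) has_real_derivative 0) (at u)"
    (is "_ \<longleftrightarrow> (?G has_real_derivative 0) _")
proof -
  let ?v = "curve_deriv s" and ?w = "curve_deriv (curve_deriv s) u"
  have v: "?v u \<noteq> 0" using assms(2) by (simp add: regular_curve_def)
  have ds: "(s has_derivative (\<lambda>h. h *\<^sub>R ?v u)) (at u)"
    using smooth_curve_has_vector_derivative[OF assms(1)]
    by (simp add: has_vector_derivative_def)
  have dv: "(?v has_derivative (\<lambda>h. h *\<^sub>R ?w)) (at u)"
    using smooth_curve_has_vector_derivative[OF smooth_curve_curve_deriv[OF assms(1)]]
    by (simp add: has_vector_derivative_def)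
  have dn: "((\<lambda>x. norm (?v x)) has_real_derivative (?v u \<bullet> ?w) / norm (?v u)) (at u)"
    unfolding has_field_derivative_def
    by (rule has_derivative_eq_rhs[OF has_derivative_compose[OF dv has_derivative_norm[OF v]]])
      (simp add: sgn_div_norm inner_commute fun_eq_iff divide_inverse_commute)
  define Q where "Q = (case p of None \<Rightarrow> ?v u \<bullet> ?w
    | Some q \<Rightarrow> (?v u \<bullet> ?w) * ((q - s u) \<bullet> (q - s u)) +
        ((2 * (norm (?v u))\<^sup>2) *\<^sub>R ?v u) \<bullet> (q - s u))"
  have Q: "p \<in> orth_circle s u \<longleftrightarrow> Q = 0"
    unfolding orth_circle_eq_pencil[OF assms(2)] by (cases p) (simp_all add: in_pencil Q_def)
  have "(?G has_real_derivative - Q / norm (?v u) ^ 3) (at u)"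
  proof (cases p)
    case None
    then show ?thesis
      using v
      by (auto intro!: derivative_eq_intros dn simp: Q_def power_def numeral_eq_Suc)
  next
    case (Some q)
    have "((\<lambda>x. (s x - q) \<bullet> (s x - q)) has_real_derivative 2 * (?v u \<bullet> (s u - q))) (at u)"
      unfolding has_field_derivative_def
      by (rule has_derivative_eq_rhs, (rule derivative_intros ds)+)
        (simp add: inner_commute fun_eq_iff algebra_simps)
    from DERIV_divide[OF this dn]
    have "((\<lambda>x. (s x - q) \<bullet> (s x - q) / norm (?v x)) has_real_derivative
        (2 * (?v u \<bullet> (s u - q)) * norm (?v u) -
          (s u - q) \<bullet> (s u - q) * ((?v u \<bullet> ?w) / norm (?v u))) /
        (norm (?v u) * norm (?v u))) (at u)" (is "(_ has_real_derivative ?D) _")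
      using v by simp
    moreover have "?D = - Q / norm (?v u) ^ 3"
    proof -
      have "(q - s u) \<bullet> (q - s u) = (s u - q) \<bullet> (s u - q)"
        "?v u \<bullet> (q - s u) = - (?v u \<bullet> (s u - q))"
        by (simp_all add: algebra_simps inner_commute)
      then show ?thesis
        using v by (simp add: Q_def Some field_simps power_def numeral_eq_Suc)
    qed
    ultimately show ?thesis
      using Some by (simp add: dist_norm dot_square_norm)
  qed
  then show ?thesis
    unfolding Q using v by (auto dest: DERIV_unique)
qed

lemma common_point_iff_speed:
  assumes "smooth_curve s" "regular_curve s"
  shows "(\<forall>u. p \<in> orth_circle s u) \<longleftrightarrow>
    (\<exists>c>0. \<forall>u. (hdist (Some (s u)) p)\<^sup>2 = c * norm (curve_deriv s u))"
proof -
  let ?G = "\<lambda>x. (hdist (Some (s x)) p)\<^sup>2 / norm (curve_deriv s x)"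
  have v: "curve_deriv s u \<noteq> 0" for u using assms(2) by (simp add: regular_curve_def)
  have G: "?G u = c \<longleftrightarrow> (hdist (Some (s u)) p)\<^sup>2 = c * norm (curve_deriv s u)" for u c
    using v[of u] by (simp add: divide_eq_eq)
  have "(\<forall>u. p \<in> orth_circle s u) \<longleftrightarrow> (\<forall>u. (?G has_real_derivative 0) (at u))"
    using in_orth_circle_iff_stationary[OF assms] by simp
  also have "\<dots> \<longleftrightarrow> (\<exists>c. \<forall>u. ?G u = c)"
  proof
    assume *: "\<forall>u. (?G has_real_derivative 0) (at u)"
    have "?G u = ?G 0" for u
      using DERIV_isconst_all[of ?G u 0] * by blast
    then show "\<exists>c. \<forall>u. ?G u = c" by blast
  next
    assume "\<exists>c. \<forall>u. ?G u = c"
    then obtain c where "?G = (\<lambda>_. c)" by blast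
    then show "\<forall>u. (?G has_real_derivative 0) (at u)" by simp
  qed
  also have "\<dots> \<longleftrightarrow> (\<exists>c>0. \<forall>u. ?G u = c)"
  proof
    assume "\<exists>c. \<forall>u. ?G u = c"
    then obtain c where c: "\<And>u. ?G u = c" by blast
    have "c \<noteq> 0"
    proof
      assume "c = 0"
      then have "hdist (Some (s u)) p = 0" for u using c[of u] v[of u] by simp
      then obtain q where "s = (\<lambda>_. q)" by (cases p) auto
      then have "curve_deriv s 0 = 0" by (simp add: curve_deriv_def)
      then show False using v by blast
    qed
    moreover have "c \<ge> 0" using c[of 0, symmetric] by simp
    ultimately show "\<exists>c>0. \<forall>u. ?G u = c" using c by (intro exI[of _ c]) auto
  qed blast
  finally show ?thesis by (simp only: G)
qed

section \<open>Moebius equivalence to an arc length parametrization\<close>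

text \<open>The inversion with center \<open>p\<close> and radius \<open>\<surd>c\<close> multiplies the speed by \<open>c / |s - p|\<^sup>2\<close>, which
  the hypothesis turns into \<open>1 / |s'|\<close>.\<close>

lemma unit_speed_moebius_image:
  assumes "smooth_curve s" "regular_curve s" "c > 0"
    and speed: "\<And>u. (hdist (Some (s u)) p)\<^sup>2 = c * norm (curve_deriv s u)"
  obtains t where "arc_length_parametrized t" "moebius_equivalent s t"
proof (cases p)
  case None
  have "smooth_curve (\<lambda>u. c *\<^sub>R s u)"
    by (rule smooth_curve_bounded_linear[OF assms(1) bounded_linear_scaleR_right])
  moreover have "curve_deriv (\<lambda>u. c *\<^sub>R s u) u = c *\<^sub>R curve_deriv s u" for u
    unfolding curve_deriv_def[of "\<lambda>u. c *\<^sub>R s u"]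
    by (intro vector_derivative_at bounded_linear.has_vector_derivative[OF
          bounded_linear_scaleR_right] smooth_curve_has_vector_derivative assms(1))
  moreover have "c * norm (curve_deriv s u) = 1" for u using speed[of u] None by simp
  ultimately have "arc_length_parametrized (\<lambda>u. c *\<^sub>R s u)"
    using assms(3) by (simp add: arc_length_parametrized_def)
  then show thesis using moebius_equivalent_scaling[OF assms(3)] by (rule that)
next
  case (Some q)
  let ?t = "\<lambda>u. q + of_real c / cnj (s u - q)"
  have speed': "(dist (s u) q)\<^sup>2 = c * norm (curve_deriv s u)" for u
    using speed[of u] Some by simp
  have sq: "s u \<noteq> q" for u
    using speed'[of u] assms(2,3) by (auto simp: regular_curve_def)
  have "curve_deriv ?t u = - (of_real c * cnj (curve_deriv s u) / (cnj (s u - q))\<^sup>2)" for u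
    unfolding curve_deriv_def[of ?t]
    by (intro vector_derivative_at has_vector_derivative_inversion
        smooth_curve_has_vector_derivative assms(1) sq)
  then have "norm (curve_deriv ?t u) = c * norm (curve_deriv s u) / (dist (s u) q)\<^sup>2" for u
    using assms(3)
    by (simp add: norm_mult norm_divide norm_power dist_norm del: complex_cnj_diff)
  then have "norm (curve_deriv ?t u) = 1" for u
    using speed'[of u] sq[of u] by (metis divide_self dist_eq_0_iff power_eq_0_iff)
  moreover have "smooth_curve ?t"
    using assms(3) by (intro smooth_curve_inversion assms(1) sq) simp
  ultimately have "arc_length_parametrized ?t" by (simp add: arc_length_parametrized_def)
  moreover have "moebius_equivalent s ?t"
  proof -
    have "circle_inversion q (sqrt c) (Some (s u)) = Some (?t u)" for u
      using assms(3) sq[of u] by (simp flip: of_real_power)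
    moreover have "moebius (circle_inversion q (sqrt c))"
      using assms(3) by (intro moebius_inversion) simp
    ultimately show ?thesis unfolding moebius_equivalent_def by blast
  qed
  ultimately show thesis by (rule that)
qed

theorem corollary15:
  fixes s :: "real \<Rightarrow> complex"
  assumes "smooth_curve s" and "regular_curve s"
  shows "(\<exists>t. arc_length_parametrized t \<and> moebius_equivalent s t) \<longleftrightarrow>
         (\<exists>p::ext_complex. \<forall>u. p \<in> orth_circle s u)"
proof
  assume "\<exists>t. arc_length_parametrized t \<and> moebius_equivalent s t"
  then obtain t where t: "smooth_curve t" "\<And>u. norm (curve_deriv t u) = 1" "moebius_equivalent s t"
    unfolding arc_length_parametrized_def by blast
  obtain p K where K: "K > 0"
    "\<And>u. norm (curve_deriv s u) = K * (hdist (Some (s u)) p)\<^sup>2 * norm (curve_deriv t u)"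
    by (rule moebius_equivalent_speed[OF t(3) smooth_curve_has_vector_derivative[OF assms(1)]
        smooth_curve_has_vector_derivative[OF t(1)]], rule that)
  have "(hdist (Some (s u)) p)\<^sup>2 = 1 / K * norm (curve_deriv s u)" for u
    using K(1) K(2)[of u] t(2)[of u] by simp
  moreover have "1 / K > 0" using K(1) by simp
  ultimately have "\<forall>u. p \<in> orth_circle s u"
    unfolding common_point_iff_speed[OF assms] by blast
  then show "\<exists>p. \<forall>u. p \<in> orth_circle s u" ..
next
  assume "\<exists>p. \<forall>u. p \<in> orth_circle s u"
  then obtain p c where "c > 0" "\<And>u. (hdist (Some (s u)) p)\<^sup>2 = c * norm (curve_deriv s u)"
    unfolding common_point_iff_speed[OF assms] by blast
  then show "\<exists>t. arc_length_parametrized t \<and> moebius_equivalent s t"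
    using unit_speed_moebius_image[OF assms] by blast
qed

end
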